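(* Let $n\ge 2$ and $m\ge 1$. Let $G=(V,E)$ be a connected graph on $V=\{1,2,\dots,n\}$ with distance matrix $D$, and let $K_{m+1}$ be the complete graph on $\{n,n+1,\dots,n+m\}$. Let $\tilde G=G\star K_{m+1}$ be the graph with vertex set $\{1,2,\dots,n+m\}$ and edge set $E\cup\{\{i,j\}: n\le i<j\le n+m\}$. If $\mathrm{QEC}(G)<0$ and there exists $f_0\in C(V)$ such that $$\mathrm{QEC}(G)=\langle f_0,Df_0\rangle,\qquad \langle f_0,f_0\rangle=1,\qquad \langle \mathbf 1,f_0\rangle=0$$ and $f_0(n)\neq 0$, then $$\mathrm{QEC}(G)<\mathrm{QEC}(G\star K_{m+1})<0.$$
   Context: All graphs are finite, simple and undirected. For a connected graph $G=(V,E)$ with $|V|\ge2$, $d(i,j)$ denotes the length of a shortest walk connecting $i$ and $j$ (with $d(i,i)=0$), and $D=[d(i,j)]_{i,j\in V}$ is the distance matrix. $C(V)$ is the space of real-valued functions on $V$, $\langle\cdot,\cdot\rangle$ its canonical inner product, and $\mathbf 1$ the constant function with value $1$. The quadratic embedding constant of $G$ is $$\mathrm{QEC}(G)=\max\{\langle f,Df\rangle : f\in C(V),\ \langle f,f\rangle=1,\ \langle \mathbf 1,f\rangle=0\}.$$ *)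

theory Defs
  imports Complex_Main
begin

definition simple_graph :: "'a set \<Rightarrow> 'a set set \<Rightarrow> bool" where
  "simple_graph V E \<longleftrightarrow>
     finite V \<and> (\<forall>e\<in>E. \<exists>u v. u \<in> V \<and> v \<in> V \<and> u \<noteq> v \<and> e = {u, v})"

text \<open>A walk is the nonempty list of its vertices; a walk of length \<open>k\<close> has \<open>k + 1\<close> entries.\<close>

definition walk_between :: "'a set \<Rightarrow> 'a set set \<Rightarrow> 'a \<Rightarrow> 'a list \<Rightarrow> 'a \<Rightarrow> bool" where
  "walk_between V E i xs j \<longleftrightarrow>
     xs \<noteq> [] \<and> set xs \<subseteq> V \<and> hd xs = i \<and> last xs = j \<and>
     successively (\<lambda>u v. {u, v} \<in> E) xs"

definition connected_graph :: "'a set \<Rightarrow> 'a set set \<Rightarrow> bool" where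
  "connected_graph V E \<longleftrightarrow>
     simple_graph V E \<and> V \<noteq> {} \<and> (\<forall>i\<in>V. \<forall>j\<in>V. \<exists>xs. walk_between V E i xs j)"

definition graph_dist :: "'a set \<Rightarrow> 'a set set \<Rightarrow> 'a \<Rightarrow> 'a \<Rightarrow> nat" where
  "graph_dist V E i j = (LEAST k. \<exists>xs. walk_between V E i xs j \<and> length xs = Suc k)"

text \<open>Functions and matrices on \<open>V\<close> are represented by total functions of which only the
  values on \<open>V\<close> matter: every inner product and matrix product sums over \<open>V\<close>.\<close>

definition distance_matrix :: "'a set \<Rightarrow> 'a set set \<Rightarrow> 'a \<Rightarrow> 'a \<Rightarrow> real" where
  "distance_matrix V E = (\<lambda>i j. real (graph_dist V E i j))"

definition inner_on :: "'a set \<Rightarrow> ('a \<Rightarrow> real) \<Rightarrow> ('a \<Rightarrow> real) \<Rightarrow> real" where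
  "inner_on V f g = (\<Sum>i\<in>V. f i * g i)"

definition mat_apply_on :: "'a set \<Rightarrow> ('a \<Rightarrow> 'a \<Rightarrow> real) \<Rightarrow> ('a \<Rightarrow> real) \<Rightarrow> 'a \<Rightarrow> real" where
  "mat_apply_on V A f = (\<lambda>i. \<Sum>j\<in>V. A i j * f j)"

text \<open>\<open>GREATEST\<close> expresses the maximum of a set of reals that is in general infinite;
  \<open>Max\<close> is meaningful for finite sets only.\<close>

definition QEC :: "'a set \<Rightarrow> 'a set set \<Rightarrow> real" where
  "QEC V E = (GREATEST x. x \<in>
     {inner_on V f (mat_apply_on V (distance_matrix V E) f) | f.
        inner_on V f f = 1 \<and> inner_on V (\<lambda>_. 1) f = 0})"

text \<open>The star product of a graph on \<open>{1..n}\<close> with edge set \<open>E\<close> and the complete graph on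
  \<open>{n..n + m}\<close>, glued at the vertex \<open>n\<close>.\<close>

definition star_complete_verts :: "nat \<Rightarrow> nat \<Rightarrow> nat set" where
  "star_complete_verts n m = {1..n + m}"

definition star_complete_edges :: "nat \<Rightarrow> nat \<Rightarrow> nat set set \<Rightarrow> nat set set" where
  "star_complete_edges n m E = E \<union> {{i, j} | i j. n \<le> i \<and> i < j \<and> j \<le> n + m}"

end

theory Submission
  imports Defs "HOL-Analysis.Function_Topology"
begin

text \<open>
  Collapsing the attached clique onto the gluing vertex \<open>n\<close>, by \<open>r i = min n i\<close>, maps the star
  product onto \<open>G\<close>.  With \<open>K = {n<..n + m}\<close> the set of new vertices, the distance matrix \<open>D'\<close> of
  the star product is the pullback of \<open>D\<close> along \<open>r\<close> plus a correction that is \<open>1\<close> exactly at those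
  pairs \<open>i \<noteq> j\<close> of which at least one lies in \<open>K\<close> (\<open>distance_matrix_star_complete\<close>).  The pullback
  part of the quadratic form of \<open>f\<close> is the quadratic form of \<open>D\<close> at the pushforward \<open>g\<close>, whose
  values are the sums of \<open>f\<close> over the fibers of \<open>r\<close>; the correction is easily summed when \<open>f\<close> has
  total sum \<open>0\<close>.  This gives the identity
  \<open>\<langle>f, D' f\<rangle> = \<langle>g, D g\<rangle> - (\<Sum>k\<in>K. f k)\<^sup>2 - (\<Sum>k\<in>K. (f k)\<^sup>2)\<close>
  (\<open>quadratic_form_star_complete\<close>), in which \<open>g\<close> again has sum \<open>0\<close>.

  Both inequalities can be read off from it.  If \<open>QEC G < 0\<close>, then every term on the right is
  nonpositive, and they vanish together only for \<open>f = 0\<close>; since the maximum that defines the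
  constant of the star product is attained, it is negative.  Conversely, moving a
  mass \<open>s\<close> from \<open>n\<close> to \<open>n + 1\<close> in a maximizer \<open>f\<^sub>0\<close> leaves the pushforward equal to \<open>f\<^sub>0\<close>,
  costs only \<open>2 * s\<^sup>2\<close> in the quadratic form, and changes the squared norm to first
  order in \<open>s\<close> because \<open>f\<^sub>0 n \<noteq> 0\<close>.  As the quadratic form is negative, increasing the norm
  increases the Rayleigh quotient, so a small \<open>s\<close> of the right sign beats \<open>QEC G\<close>.
\<close>

section \<open>The maximum defining the quadratic embedding constant\<close>

lemma inner_mat_apply_scale:
  "inner_on V (\<lambda>i. c * f i) (mat_apply_on V A (\<lambda>i. c * f i)) =
     c\<^sup>2 * inner_on V f (mat_apply_on V A f)"
  unfolding inner_on_def mat_apply_on_def sum_distrib_left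
  by (intro sum.cong refl) (simp add: power2_eq_square algebra_simps)

lemma inner_on_scale: "inner_on V (\<lambda>i. c * f i) (\<lambda>i. c * f i) = c\<^sup>2 * inner_on V f f"
  unfolding inner_on_def sum_distrib_left
  by (intro sum.cong refl) (simp add: power2_eq_square algebra_simps)

lemma inner_on_one_scale: "inner_on V (\<lambda>_. 1) (\<lambda>i. c * f i) = c * inner_on V (\<lambda>_. 1) f"
  by (simp add: inner_on_def sum_distrib_left)

lemma inner_on_self_nonneg: "0 \<le> inner_on V f f"
  by (simp add: inner_on_def sum_nonneg)

lemma inner_on_self_eq_0: "finite V \<Longrightarrow> inner_on V f f = 0 \<longleftrightarrow> (\<forall>i\<in>V. f i = 0)"
  by (simp add: inner_on_def sum_nonneg_eq_0_iff)

text \<open>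
  The constraints cut out the unit sphere of a hyperplane in \<open>\<real>\<^bsup>V\<^esup>\<close>, which is compact, and the form is
  continuous.  As only the values on \<open>V\<close> matter, it suffices to consider functions vanishing off
  \<open>V\<close>; those of norm \<open>1\<close> lie in a cube, compact in the product topology.  Two distinct points
  are needed for the constraints to be satisfiable at all.
\<close>

lemma quadratic_form_attains_max:
  fixes A :: "'a \<Rightarrow> 'a \<Rightarrow> real"
  assumes fin: "finite V" and uv: "u \<in> V" "v \<in> V" "u \<noteq> v"
  obtains f where "inner_on V f f = 1" "inner_on V (\<lambda>_. 1) f = 0"
    "\<And>g. inner_on V g g = 1 \<Longrightarrow> inner_on V (\<lambda>_. 1) g = 0 \<Longrightarrow>
       inner_on V g (mat_apply_on V A g) \<le> inner_on V f (mat_apply_on V A f)"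
proof -
  define B :: "('a \<Rightarrow> real) set"
    where "B = (\<Pi>\<^sub>E i\<in>UNIV. if i \<in> V then {-1..1} else {0})"
  define C where "C = {f. inner_on V f f = 1} \<inter> {f. inner_on V (\<lambda>_. 1) f = 0}"
  define q where "q = (\<lambda>f. inner_on V f (mat_apply_on V A f))"
  have coord: "continuous_on S (\<lambda>f :: 'a \<Rightarrow> real. f i)" for S i
    by (rule continuous_on_subset[OF continuous_on_product_coordinates]) auto
  have "compactin (product_topology (\<lambda>_. euclidean) UNIV) B"
    unfolding B_def compactin_PiE by auto
  then have "compact B"
    by (simp add: euclidean_product_topology)
  moreover have "closed C"
    unfolding C_def inner_on_def
    by (intro closed_Int closed_Collect_eq continuous_intros coord)
  ultimately have comp: "compact (B \<inter> C)"
    by (rule compact_Int_closed)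
  have cut: "\<exists>h\<in>B \<inter> C. q h = q g" if g: "g \<in> C" for g
  proof
    define h where "h = (\<lambda>i. if i \<in> V then g i else 0)"
    have "\<bar>g i\<bar> \<le> 1" if "i \<in> V" for i
    proof -
      have "g i * g i \<le> inner_on V g g"
        unfolding inner_on_def by (rule member_le_sum) (use that fin in auto)
      then have "(g i)\<^sup>2 \<le> 1" using g by (simp add: C_def power2_eq_square)
      then show ?thesis by (simp add: abs_square_le_1)
    qed
    then have "h \<in> B" by (auto simp: B_def h_def abs_le_iff)
    moreover have "h \<in> C" using g by (simp add: C_def h_def inner_on_def)
    ultimately show "h \<in> B \<inter> C" by simp
    show "q h = q g"
      by (simp add: q_def h_def inner_on_def mat_apply_on_def)
  qed
  \<comment> \<open>a function satisfying both constraints, so that the maximum is over a nonempty set\<close>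
  define w where "w = (\<lambda>i. if i = u then sqrt (1/2) else if i = v then - sqrt (1/2) else 0)"
  have Vuv: "V = insert u (insert v (V - {u, v}))" using uv by auto
  have w0: "w i = 0" if "i \<in> V - {u, v}" for i using that by (simp add: w_def)
  have "w \<in> C"
    unfolding C_def inner_on_def
    using fin uv(3) w0 by (subst (1 2) Vuv) (simp add: w_def)
  then have "B \<inter> C \<noteq> {}" using cut by blast
  moreover have "continuous_on (B \<inter> C) q"
    unfolding q_def inner_on_def mat_apply_on_def by (intro continuous_intros coord)
  ultimately obtain f where f: "f \<in> B \<inter> C" "\<And>h. h \<in> B \<inter> C \<Longrightarrow> q h \<le> q f"
    using continuous_attains_sup[OF comp] by blast
  have "q g \<le> q f" if "g \<in> C" for g using cut[OF that] f(2) by metis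
  then show thesis using f(1) that[of f] by (auto simp: C_def q_def)
qed

text \<open>
  Attainment is what makes \<open>GREATEST\<close> in the definition of \<open>QEC\<close> denote the actual maximum.  The
  homogeneous form of the upper bound spares normalizing test functions.
\<close>

lemma
  assumes "finite V" "u \<in> V" "v \<in> V" "u \<noteq> v"
  shows QEC_attained: "\<exists>f. inner_on V f f = 1 \<and> inner_on V (\<lambda>_. 1) f = 0 \<and>
      inner_on V f (mat_apply_on V (distance_matrix V E) f) = QEC V E" (is ?attained)
    and QEC_upper: "inner_on V (\<lambda>_. 1) g = 0 \<Longrightarrow>
      inner_on V g (mat_apply_on V (distance_matrix V E) g) \<le> QEC V E * inner_on V g g"
proof -
  let ?q = "\<lambda>f. inner_on V f (mat_apply_on V (distance_matrix V E) f)"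
  obtain f where f: "inner_on V f f = 1" "inner_on V (\<lambda>_. 1) f = 0"
    "\<And>g. inner_on V g g = 1 \<Longrightarrow> inner_on V (\<lambda>_. 1) g = 0 \<Longrightarrow> ?q g \<le> ?q f"
    using quadratic_form_attains_max[OF assms] by metis
  have QEC: "QEC V E = ?q f"
    unfolding QEC_def by (rule Greatest_equality) (use f in auto)
  show ?attained using f QEC by metis
  show "?q g \<le> QEC V E * inner_on V g g" if g: "inner_on V (\<lambda>_. 1) g = 0"
  proof (cases "inner_on V g g = 0")
    case True
    then have "\<forall>i\<in>V. g i = 0" using assms by (simp add: inner_on_self_eq_0)
    then have "?q g = 0" by (simp add: inner_on_def)
    then show ?thesis using True by simp
  next
    case False
    define N where "N = inner_on V g g"
    have N: "N > 0" using False inner_on_self_nonneg[of V g] by (simp add: N_def)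
    define c where "c = 1 / sqrt N"
    have c: "c\<^sup>2 * N = 1" using N by (simp add: c_def power_divide)
    have "?q (\<lambda>i. c * g i) \<le> QEC V E"
      unfolding QEC
      by (rule f(3)) (use g c in \<open>simp_all add: inner_on_scale inner_on_one_scale N_def\<close>)
    then have "c\<^sup>2 * ?q g \<le> QEC V E" by (simp add: inner_mat_apply_scale)
    then have "N * (c\<^sup>2 * ?q g) \<le> N * QEC V E" using N by (intro mult_left_mono) auto
    moreover have "N * (c\<^sup>2 * ?q g) = (c\<^sup>2 * N) * ?q g" by (simp add: algebra_simps)
    ultimately show ?thesis unfolding c by (simp add: N_def[symmetric] mult.commute)
  qed
qed

section \<open>Walks and distances\<close>

lemma walk_between_rev: "walk_between V E i xs j \<Longrightarrow> walk_between V E j (rev xs) i"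
  by (auto simp: walk_between_def hd_rev last_rev insert_commute)

lemma graph_dist_commute: "graph_dist V E i j = graph_dist V E j i"
proof -
  have "(\<exists>xs. walk_between V E i xs j \<and> length xs = Suc k) \<longleftrightarrow>
        (\<exists>xs. walk_between V E j xs i \<and> length xs = Suc k)" for k
    by (metis walk_between_rev length_rev)
  then show ?thesis by (simp add: graph_dist_def)
qed

lemma graph_dist_le: "walk_between V E i xs j \<Longrightarrow> graph_dist V E i j \<le> length xs - 1"
  unfolding graph_dist_def by (rule Least_le) (auto simp: walk_between_def)

lemma graph_dist_walk:
  assumes "walk_between V E i xs j"
  obtains ys where "walk_between V E i ys j" "length ys = Suc (graph_dist V E i j)"
proof -
  have "\<exists>ys. walk_between V E i ys j \<and> length ys = Suc (length xs - 1)"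
    using assms by (auto simp: walk_between_def)
  from LeastI[where P = "\<lambda>k. \<exists>ys. walk_between V E i ys j \<and> length ys = Suc k", OF this]
  show thesis using that by (auto simp: graph_dist_def)
qed

lemma graph_dist_refl: "i \<in> V \<Longrightarrow> graph_dist V E i i = 0"
  using graph_dist_le[of V E i "[i]" i] by (simp add: walk_between_def)

lemma successively_remdups_adj:
  "successively (\<lambda>u v. R u v \<or> u = v) xs \<Longrightarrow> successively R (remdups_adj xs)"
  by (induction xs rule: remdups_adj.induct)
    (auto simp: successively_Cons split: if_splits)

text \<open>
  A map sending each edge to an edge or to a single vertex does not increase distances: the image
  of a walk becomes a walk once the repetitions of consecutive vertices are removed.
\<close>

lemma graph_dist_contract:
  assumes walk: "walk_between W F i xs j"
    and vert: "\<And>u. u \<in> W \<Longrightarrow> r u \<in> V"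
    and edge: "\<And>u v. u \<in> W \<Longrightarrow> v \<in> W \<Longrightarrow> {u, v} \<in> F \<Longrightarrow> {r u, r v} \<in> E \<or> r u = r v"
  shows "graph_dist V E (r i) (r j) \<le> length xs - 1"
proof -
  let ?ys = "remdups_adj (map r xs)"
  from walk have xs: "xs \<noteq> []" "set xs \<subseteq> W" "hd xs = i" "last xs = j"
    "successively (\<lambda>u v. {u, v} \<in> F) xs" by (auto simp: walk_between_def)
  have "successively (\<lambda>u v. {r u, r v} \<in> E \<or> r u = r v) xs"
    by (rule successively_mono[OF xs(5)]) (use xs(2) edge in blast)
  then have "successively (\<lambda>u v. {u, v} \<in> E) ?ys"
    by (intro successively_remdups_adj) (simp add: successively_map)
  then have "walk_between V E (r i) ?ys (r j)"
    using xs vert by (auto simp: walk_between_def hd_map last_map)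
  then have "graph_dist V E (r i) (r j) \<le> length ?ys - 1" by (rule graph_dist_le)
  also have "\<dots> \<le> length xs - 1" using remdups_adj_length[of "map r xs"] by simp
  finally show ?thesis .
qed

text \<open>
  Lower bounds on distances in the star product come from collapsing the clique onto \<open>n\<close>.  The
  extra \<open>1\<close> between an old and a new vertex arises because the last step of a walk into a new vertex
  starts in the clique: without that step, the walk still collapses to one that ends in \<open>n\<close>.
\<close>

lemma distance_matrix_star_complete:
  assumes conn: "connected_graph {1..n} E" and n: "n \<ge> 1"
    and i: "i \<in> {1..n + m}" and j: "j \<in> {1..n + m}"
  shows "distance_matrix (star_complete_verts n m) (star_complete_edges n m E) i j =
    distance_matrix {1..n} E (min n i) (min n j)
      + 1 - of_bool (i \<le> n) * of_bool (j \<le> n) - of_bool (i = j \<and> n < i)"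
proof -
  let ?W = "{1..n + m}" and ?F = "star_complete_edges n m E"
  let ?d = "graph_dist {1..n} E" and ?d' = "graph_dist ?W ?F"
  have simple: "simple_graph {1..n} E"
    and walks: "\<And>i j. i \<in> {1..n} \<Longrightarrow> j \<in> {1..n} \<Longrightarrow> \<exists>xs. walk_between {1..n} E i xs j"
    using conn by (auto simp: connected_graph_def)
  have E: "u \<in> {1..n} \<and> v \<in> {1..n}" if "{u, v} \<in> E" for u v
    using simple that unfolding simple_graph_def by (metis doubleton_eq_iff)
  have F: "{u, v} \<in> ?F \<longleftrightarrow> {u, v} \<in> E \<or> (u \<noteq> v \<and> n \<le> u \<and> n \<le> v \<and> u \<le> n + m \<and> v \<le> n + m)"
    for u v
    unfolding star_complete_edges_def
    by (auto simp: doubleton_eq_iff) (metis linorder_neqE_nat)+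
  have walk_mono: "walk_between ?W ?F u xs v" if "walk_between {1..n} E u xs v" for u xs v
    using that by (auto simp: walk_between_def F elim!: successively_mono)
  have contract: "?d (min n u) (min n v) \<le> length xs - 1" if "walk_between ?W ?F u xs v" for u xs v
  proof (rule graph_dist_contract[OF that])
    show "min n x \<in> {1..n}" if "x \<in> ?W" for x using that n by auto
    show "{min n x, min n y} \<in> E \<or> min n x = min n y" if "{x, y} \<in> ?F" for x y
      using that E[of x y] by (auto simp: F)
  qed
  have nn: "n \<in> {1..n}" using n by auto
  have old_old: "?d' u v = ?d u v" if uv: "u \<in> {1..n}" "v \<in> {1..n}" for u v
  proof -
    obtain xs where xs: "walk_between {1..n} E u xs v" "length xs = Suc (?d u v)"
      using graph_dist_walk walks[OF uv] by metis
    obtain ys where ys: "walk_between ?W ?F u ys v" "length ys = Suc (?d' u v)"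
      using graph_dist_walk walk_mono[OF xs(1)] by metis
    from contract[OF ys(1)] graph_dist_le[OF walk_mono[OF xs(1)]] xs(2) ys(2) uv
    show ?thesis by (simp add: min_absorb2)
  qed
  have old_new: "?d' u k = ?d u n + 1" if u: "u \<in> {1..n}" and k: "n < k" "k \<le> n + m" for u k
  proof -
    obtain xs where xs: "walk_between {1..n} E u xs n" "length xs = Suc (?d u n)"
      using graph_dist_walk walks[OF u nn] by metis
    have walk: "walk_between ?W ?F u (xs @ [k]) k"
      using walk_mono[OF xs(1)] k n
      by (auto simp: walk_between_def successively_append_iff F)
    obtain ys where ys: "walk_between ?W ?F u ys k" "length ys = Suc (?d' u k)"
      using graph_dist_walk[OF walk] by metis
    define zs where "zs = butlast ys"
    have ys_eq: "ys = zs @ [k]"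
      using ys(1) by (metis walk_between_def append_butlast_last_id zs_def)
    have "zs \<noteq> []" using ys(1) u k by (auto simp: walk_between_def ys_eq)
    then have step: "walk_between ?W ?F u zs (last zs)" "{last zs, k} \<in> ?F"
      using ys(1) by (auto simp: walk_between_def ys_eq successively_append_iff)
    then have "n \<le> last zs" using E[of "last zs" k] k by (auto simp: F)
    then have "?d u n \<le> length zs - 1" using contract[OF step(1)] u by (simp add: min_absorb2)
    moreover have "?d' u k \<le> length (xs @ [k]) - 1" by (rule graph_dist_le[OF walk])
    ultimately show ?thesis using xs(2) ys(2) \<open>zs \<noteq> []\<close> ys_eq by (cases zs) auto
  qed
  have new_new: "?d' k l = (if k = l then 0 else 1)"
    if "n < k" "k \<le> n + m" "n < l" "l \<le> n + m" for k l
  proof (cases "k = l")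
    case True
    then show ?thesis using that by (simp add: graph_dist_refl)
  next
    case False
    then have walk: "walk_between ?W ?F k [k, l] l"
      using that n by (auto simp: walk_between_def F)
    obtain ys where ys: "walk_between ?W ?F k ys l" "length ys = Suc (?d' k l)"
      using graph_dist_walk[OF walk] by metis
    have "?d' k l \<noteq> 0"
    proof
      assume "?d' k l = 0"
      then obtain x where "ys = [x]" using ys(2) by (auto simp: length_Suc_conv)
      then show False using ys(1) False by (simp add: walk_between_def)
    qed
    then show ?thesis using graph_dist_le[OF walk] False by simp
  qed
  have "?d n n = 0" using nn by (rule graph_dist_refl)
  moreover consider "i \<le> n" "j \<le> n" | "i \<le> n" "n < j" | "n < i" "j \<le> n" | "n < i" "n < j"
    by linarith
  then have "real (?d' i j) = real (?d (min n i) (min n j)) + 1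
      - of_bool (i \<le> n) * of_bool (j \<le> n) - of_bool (i = j \<and> n < i)"
  proof cases
    case 1
    then show ?thesis using old_old i j by (simp add: min_absorb2)
  next
    case 2
    then show ?thesis using old_new i j by (simp add: min_absorb1 min_absorb2)
  next
    case 3
    then show ?thesis using old_new[of j i] i j graph_dist_commute[of ?W ?F i j]
        graph_dist_commute[of "{1..n}" E n j] by (simp add: min_absorb1 min_absorb2)
  next
    case 4
    then show ?thesis using new_new i j \<open>?d n n = 0\<close> by (simp add: min_absorb1)
  qed
  ultimately show ?thesis by (simp add: distance_matrix_def star_complete_verts_def)
qed

section \<open>The quadratic form of the star product\<close>

text \<open>The pushforward of \<open>f\<close>, seen as a signed measure on \<open>W\<close>, along \<open>r\<close>.\<close>

definition fiber_sum :: "'a set \<Rightarrow> ('a \<Rightarrow> 'b) \<Rightarrow> ('a \<Rightarrow> real) \<Rightarrow> 'b \<Rightarrow> real" where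
  "fiber_sum W r f v = (\<Sum>i\<in>{i\<in>W. r i = v}. f i)"

lemma sum_mult_fiber_sum:
  assumes "finite W" "finite V" "r ` W \<subseteq> V"
  shows "(\<Sum>v\<in>V. h v * fiber_sum W r f v) = (\<Sum>i\<in>W. h (r i) * f i)"
proof -
  have "(\<Sum>v\<in>V. h v * fiber_sum W r f v) = (\<Sum>v\<in>V. \<Sum>i\<in>{i\<in>W. r i = v}. h (r i) * f i)"
    unfolding fiber_sum_def sum_distrib_left by (intro sum.cong) auto
  also have "\<dots> = (\<Sum>i\<in>W. h (r i) * f i)" using assms by (rule sum.group)
  finally show ?thesis .
qed

text \<open>Pushforward is adjoint to pullback, applied here in each of the two arguments of \<open>A\<close>.\<close>

lemma quadratic_form_fiber_sum:
  assumes "finite W" "finite V" "r ` W \<subseteq> V"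
  shows "inner_on V (fiber_sum W r f) (mat_apply_on V A (fiber_sum W r f)) =
    inner_on W f (mat_apply_on W (\<lambda>i j. A (r i) (r j)) f)"
proof -
  let ?h = "\<lambda>u. \<Sum>j\<in>W. A u (r j) * f j"
  have "inner_on V (fiber_sum W r f) (mat_apply_on V A (fiber_sum W r f)) =
      (\<Sum>u\<in>V. ?h u * fiber_sum W r f u)"
    by (simp add: inner_on_def mat_apply_on_def sum_mult_fiber_sum[OF assms] mult.commute)
  also have "\<dots> = (\<Sum>i\<in>W. ?h (r i) * f i)" by (rule sum_mult_fiber_sum[OF assms])
  finally show ?thesis by (simp add: inner_on_def mat_apply_on_def mult.commute)
qed

text \<open>
  The correction to the pulled-back distance matrix is the all-ones matrix, minus the all-ones block
  of the old vertices, minus the identity on the new ones.  Since \<open>f\<close> has sum \<open>0\<close>, the first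
  contributes nothing, and its sum over the old vertices is minus its sum over the new ones; so the
  other two contribute the two squares.
\<close>

lemma quadratic_form_star_complete:
  fixes n m :: nat
  defines "W \<equiv> {1..n + m}"
  assumes conn: "connected_graph {1..n} E" and n: "n \<ge> 1"
    and f: "inner_on W (\<lambda>_. 1) f = 0"
  defines "g \<equiv> fiber_sum W (min n) f"
  shows "inner_on W f (mat_apply_on W (distance_matrix W (star_complete_edges n m E)) f) =
     inner_on {1..n} g (mat_apply_on {1..n} (distance_matrix {1..n} E) g)
       - (\<Sum>k\<in>{n<..n + m}. f k)\<^sup>2 - (\<Sum>k\<in>{n<..n + m}. (f k)\<^sup>2)"
proof -
  let ?D = "distance_matrix {1..n} E" and ?K = "{n<..n + m}"
  let ?a = "\<lambda>i. of_bool (i \<le> n) :: real"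
  have W: "W = {1..n} \<union> ?K" and disj: "{1..n} \<inter> ?K = {}" using n by (auto simp: W_def)
  have split: "sum h W = sum h {1..n} + sum h ?K" for h :: "nat \<Rightarrow> real"
    unfolding W by (rule sum.union_disjoint) (use disj in auto)
  have total: "sum f W = 0" using f by (simp add: inner_on_def)
  have old: "(\<Sum>i\<in>W. ?a i * f i) = - sum f ?K"
  proof -
    have "(\<Sum>i\<in>W. ?a i * f i) = sum f {1..n}" unfolding split by simp
    then show ?thesis using total split[of f] by simp
  qed
  have new: "(\<Sum>i\<in>W. of_bool (n < i) * (f i)\<^sup>2) = (\<Sum>k\<in>?K. (f k)\<^sup>2)"
    unfolding split by simp
  have row: "(\<Sum>j\<in>W. of_bool (i = j \<and> n < i) * f j) = of_bool (n < i) * f i" if "i \<in> W" for i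
  proof -
    have "(\<Sum>j\<in>W. of_bool (i = j \<and> n < i) * f j) = (\<Sum>j\<in>W. if i = j then of_bool (n < i) * f j else 0)"
      by (intro sum.cong) auto
    also have "\<dots> = of_bool (n < i) * f i" using that by (simp add: W_def)
    finally show ?thesis .
  qed
  have app: "mat_apply_on W (distance_matrix W (star_complete_edges n m E)) f i =
      mat_apply_on W (\<lambda>i j. ?D (min n i) (min n j)) f i + ?a i * sum f ?K - of_bool (n < i) * f i"
    if i: "i \<in> W" for i
  proof -
    have "mat_apply_on W (distance_matrix W (star_complete_edges n m E)) f i =
      (\<Sum>j\<in>W. ?D (min n i) (min n j) * f j + f j - ?a i * (?a j * f j) - of_bool (i = j \<and> n < i) * f j)"
      unfolding mat_apply_on_def
    proof (intro sum.cong refl)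
      fix j assume j: "j \<in> W"
      have entry: "distance_matrix W (star_complete_edges n m E) i j =
          ?D (min n i) (min n j) + 1 - ?a i * ?a j - of_bool (i = j \<and> n < i)"
        using distance_matrix_star_complete[OF conn n, of i m j] i j
        unfolding W_def star_complete_verts_def by simp
      show "distance_matrix W (star_complete_edges n m E) i j * f j =
          ?D (min n i) (min n j) * f j + f j - ?a i * (?a j * f j) - of_bool (i = j \<and> n < i) * f j"
        unfolding entry by (simp add: algebra_simps)
    qed
    also have "\<dots> = (\<Sum>j\<in>W. ?D (min n i) (min n j) * f j) + sum f W
        - ?a i * (\<Sum>j\<in>W. ?a j * f j) - (\<Sum>j\<in>W. of_bool (i = j \<and> n < i) * f j)"
      by (simp only: sum.distrib sum_subtractf sum_distrib_left)
    finally show ?thesis by (simp add: total old row[OF i] mat_apply_on_def del: One_nat_def)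
  qed
  have "inner_on W f (mat_apply_on W (distance_matrix W (star_complete_edges n m E)) f) =
      (\<Sum>i\<in>W. f i * mat_apply_on W (\<lambda>i j. ?D (min n i) (min n j)) f i
        + (?a i * f i) * sum f ?K - of_bool (n < i) * (f i)\<^sup>2)"
    unfolding inner_on_def by (intro sum.cong refl) (simp add: app power2_eq_square algebra_simps)
  also have "\<dots> = inner_on W f (mat_apply_on W (\<lambda>i j. ?D (min n i) (min n j)) f)
      + (\<Sum>i\<in>W. ?a i * f i) * sum f ?K - (\<Sum>i\<in>W. of_bool (n < i) * (f i)\<^sup>2)"
    by (simp only: sum.distrib sum_subtractf sum_distrib_right inner_on_def)
  also have "inner_on W f (mat_apply_on W (\<lambda>i j. ?D (min n i) (min n j)) f) =
      inner_on {1..n} g (mat_apply_on {1..n} ?D g)"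
    unfolding g_def by (rule quadratic_form_fiber_sum[symmetric]) (use n in \<open>auto simp: W_def\<close>)
  finally show ?thesis by (simp only: old new) (simp add: power2_eq_square)
qed

lemma fiber_sum_min:
  fixes n m v :: nat
  assumes v: "v \<in> {1..n}"
  shows "fiber_sum {1..n + m} (min n) f v = f v + (if v = n then \<Sum>k\<in>{n<..n + m}. f k else 0)"
proof (cases "v = n")
  case True
  have "{i \<in> {1..n + m}. min n i = n} = insert n {n<..n + m}" using v True by (auto simp: min_def)
  then show ?thesis using True by (simp add: fiber_sum_def)
next
  case False
  then have "{i \<in> {1..n + m}. min n i = v} = {v}" using v by (auto simp: min_def)
  then show ?thesis using False by (simp add: fiber_sum_def)
qed

theorem theorem3p1:
  fixes n m :: nat and V :: "nat set" and E :: "nat set set"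
    and D :: "nat \<Rightarrow> nat \<Rightarrow> real"
  assumes "n \<ge> 2" and "m \<ge> 1"
    and "V = {1..n}"
    and "connected_graph V E"
    and "D = distance_matrix V E"
    and "QEC V E < 0"
    and "\<exists>f0 :: nat \<Rightarrow> real.
           QEC V E = inner_on V f0 (mat_apply_on V D f0) \<and>
           inner_on V f0 f0 = 1 \<and>
           inner_on V (\<lambda>_. 1) f0 = 0 \<and>
           f0 n \<noteq> 0"
  shows "QEC V E < QEC (star_complete_verts n m) (star_complete_edges n m E) \<and>
         QEC (star_complete_verts n m) (star_complete_edges n m E) < 0"
proof -
  let ?W = "{1..n + m}" and ?F = "star_complete_edges n m E" and ?K = "{n<..n + m}"
  let ?q = "\<lambda>f. inner_on V f (mat_apply_on V D f)"
  let ?q' = "\<lambda>f. inner_on ?W f (mat_apply_on ?W (distance_matrix ?W ?F) f)"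
  let ?push = "fiber_sum ?W (min n)"
  have verts: "star_complete_verts n m = ?W" by (simp add: star_complete_verts_def)
  have n1: "n \<ge> 1" using assms(1) by simp
  note V = assms(3) and conn = assms(4)[unfolded assms(3)] and D = assms(5) and neg = assms(6)
  have W: "?W = V \<union> ?K" and disj: "V \<inter> ?K = {}" using n1 by (auto simp: V)
  have split: "sum h ?W = sum h V + sum h ?K" for h :: "nat \<Rightarrow> real"
    unfolding W by (rule sum.union_disjoint) (use disj V in auto)
  have form: "?q' f = ?q (?push f) - (sum f ?K)\<^sup>2 - (\<Sum>k\<in>?K. (f k)\<^sup>2)"
    if "inner_on ?W (\<lambda>_. 1) f = 0" for f
    using quadratic_form_star_complete[OF conn n1 that] by (simp add: V D)
  have upper: "?q g \<le> QEC V E * inner_on V g g" if "inner_on V (\<lambda>_. 1) g = 0" for g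
    unfolding D using that by (intro QEC_upper[where u=1 and v=2]) (use assms(1) in \<open>auto simp: V\<close>)
  have upper': "?q' g \<le> QEC ?W ?F * inner_on ?W g g" if "inner_on ?W (\<lambda>_. 1) g = 0" for g
    using that by (intro QEC_upper[where u=1 and v=2]) (use assms(1) in auto)
  have "QEC ?W ?F < 0"
  proof -
    obtain f where f: "inner_on ?W f f = 1" "inner_on ?W (\<lambda>_. 1) f = 0" "?q' f = QEC ?W ?F"
      using QEC_attained[of ?W 1 2 ?F] assms(1) by auto
    let ?g = "?push f"
    have "inner_on V (\<lambda>_. 1) ?g = inner_on ?W (\<lambda>_. 1) f"
      unfolding inner_on_def by (rule sum_mult_fiber_sum) (use n1 in \<open>auto simp: V\<close>)
    then have "?q ?g \<le> QEC V E * inner_on V ?g ?g" using f(2) by (intro upper) simp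
    then have le: "QEC ?W ?F \<le> QEC V E * inner_on V ?g ?g - (sum f ?K)\<^sup>2 - (\<Sum>k\<in>?K. (f k)\<^sup>2)"
      using form[OF f(2)] f(3) by simp
    have g2: "QEC V E * inner_on V ?g ?g \<le> 0"
      using neg inner_on_self_nonneg[of V ?g] by (simp add: mult_nonpos_nonneg)
    have K2: "0 \<le> (\<Sum>k\<in>?K. (f k)\<^sup>2)" by (rule sum_nonneg) simp
    show ?thesis
    proof (rule ccontr)
      assume "\<not> QEC ?W ?F < 0"
      then have "QEC V E * inner_on V ?g ?g = 0" "(\<Sum>k\<in>?K. (f k)\<^sup>2) = 0"
        using le g2 K2 zero_le_power2[of "sum f ?K"] by linarith+
      then have g0: "\<forall>v\<in>V. ?g v = 0" and K0: "\<forall>k\<in>?K. f k = 0"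
        using neg by (auto simp: inner_on_self_eq_0 sum_nonneg_eq_0_iff V)
      have sum0: "sum f ?K = 0" using K0 by simp
      have "f v = 0" if "v \<in> V" for v
        using fiber_sum_min[of v n m f] g0 that unfolding sum0 V by (simp split: if_splits)
      then have "\<forall>i\<in>?W. f i = 0" using K0 W by auto
      then show False using f(1) by (simp add: inner_on_def)
    qed
  qed
  moreover have "QEC V E < QEC ?W ?F"
  proof -
    obtain f0 where f0: "QEC V E = ?q f0" "inner_on V f0 f0 = 1" "inner_on V (\<lambda>_. 1) f0 = 0" "f0 n \<noteq> 0"
      using assms(7) by metis
    \<comment> \<open>Moving mass \<open>s\<close> gives \<open>\<langle>f, D' f\<rangle> - q * \<langle>f, f\<rangle> = 2 * q * s * f0 n - 2 * (1 + q) * s\<^sup>2\<close>, where \<open>q\<close>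
      is \<open>QEC V E\<close>. For \<open>s = q * f0 n\<close> the first term is \<open>2 * s\<^sup>2\<close>, leaving \<open>- 2 * q * s\<^sup>2 > 0\<close>.\<close>
    define s where "s = QEC V E * f0 n"
    define f where "f = (\<lambda>i. if i \<le> n then f0 i - (if i = n then s else 0) else if i = n + 1 then s else 0)"
    have K: "?K = insert (n + 1) {n + 1<..n + m}" using assms(2) by auto
    have sumK: "sum f ?K = s" "(\<Sum>k\<in>?K. (f k)\<^sup>2) = s\<^sup>2"
      unfolding K by (simp_all add: f_def)
    have push: "?push f v = f0 v" if "v \<in> V" for v
      using fiber_sum_min[of v n m f] that unfolding sumK(1) V by (simp add: f_def)
    have "inner_on ?W (\<lambda>_. 1) f = inner_on V (\<lambda>_. 1) (?push f)"
      unfolding inner_on_def by (rule sum_mult_fiber_sum[symmetric]) (use n1 in \<open>auto simp: V\<close>)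
    also have "\<dots> = 0" using f0(3) push by (simp add: inner_on_def)
    finally have f1: "inner_on ?W (\<lambda>_. 1) f = 0" .
    have "?q (?push f) = ?q f0" using push by (simp add: inner_on_def mat_apply_on_def)
    then have val: "?q' f = QEC V E - 2 * s\<^sup>2"
      using form[OF f1] f0(1) sumK by simp
    have norm: "inner_on ?W f f = 1 - 2 * s * f0 n + 2 * s\<^sup>2"
    proof -
      have "inner_on ?W f f = (\<Sum>i\<in>V. f i * f i) + s\<^sup>2"
        using sumK(2) unfolding inner_on_def split by (simp add: power2_eq_square)
      also have "(\<Sum>i\<in>V. f i * f i) =
          (\<Sum>i\<in>V. f0 i * f0 i + (if i = n then s\<^sup>2 - 2 * s * f0 n else 0))"
        by (intro sum.cong) (auto simp: V f_def power2_eq_square algebra_simps)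
      also have "\<dots> = 1 + (s\<^sup>2 - 2 * s * f0 n)"
        using f0(2) n1 by (simp add: sum.distrib inner_on_def V)
      finally show ?thesis by simp
    qed
    have gap: "?q' f - QEC V E * inner_on ?W f f = - 2 * QEC V E * s\<^sup>2"
      unfolding val norm by (simp add: s_def power2_eq_square algebra_simps)
    have "s \<noteq> 0" using neg f0(4) by (simp add: s_def)
    then have "QEC V E * s\<^sup>2 < 0" using neg by (simp add: mult_neg_pos)
    then have "QEC V E * inner_on ?W f f < ?q' f" using gap by simp
    also have "\<dots> \<le> QEC ?W ?F * inner_on ?W f f" by (rule upper'[OF f1])
    finally show ?thesis
      using inner_on_self_nonneg[of ?W f] by (meson mult_right_mono not_less)
  qed
  ultimately show ?thesis by (simp add: verts)
qed

end
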